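(* Let $G$ be a graph with $n$ vertices in which every vertex has degree either $d$ or $d+1$. Then there exists an $r$-regular graph $R$ on the same vertex set, with $r=d$ or $r=d+1$, such that $|E(G)\,\triangle\,E(R)|\le 3n/2$. *)

theory Defs
  imports Complex_Main "HOL-Library.Ramsey"
begin

text \<open>A finite simple graph is a vertex set \<open>V\<close> together with a set \<open>E\<close> of two-element subsets
  of \<open>V\<close>.\<close>

definition simple_graph :: "'a set \<Rightarrow> 'a set set \<Rightarrow> bool" where
  "simple_graph V E \<longleftrightarrow> finite V \<and> E \<subseteq> [V]\<^bsup>2\<^esup>"

definition degree :: "'a set set \<Rightarrow> 'a \<Rightarrow> nat" where
  "degree E v = card {e \<in> E. v \<in> e}"

definition regular_graph :: "nat \<Rightarrow> 'a set \<Rightarrow> 'a set set \<Rightarrow> bool" where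
  "regular_graph r V E \<longleftrightarrow> simple_graph V E \<and> (\<forall>v\<in>V. degree E v = r)"

end

(* If the set A of vertices of degree d + 1 has even size, pair up its vertices and lower the
   degrees of each pair by an alternating trail with at most three edges; this changes at most
   3|A|/2 edges and yields a d-regular graph. By the handshake lemma A is even unless n and d are
   both odd, and then the set of vertices of degree d is even, so the same argument applied to the
   complement graph yields a (d+1)-regular graph. *)

theory Submission
  imports Defs
begin

lemma simple_graph_finite: "simple_graph V E \<Longrightarrow> finite E"
  unfolding simple_graph_def using finite_imp_finite_nsets finite_subset by blast

text \<open>The indicator covers endpoints and all other vertices in one equation, so the effect of
  several edge changes can be computed by rewriting.\<close>

lemma degree_insert:
  assumes "finite E" "e \<notin> E"
  shows "degree (insert e E) w = degree E w + of_bool (w \<in> e)"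
proof (cases "w \<in> e")
  case True
  then have "{f \<in> insert e E. w \<in> f} = insert e {f \<in> E. w \<in> f}" by auto
  then show ?thesis using True assms by (simp add: degree_def)
next
  case False
  then have "{f \<in> insert e E. w \<in> f} = {f \<in> E. w \<in> f}" by auto
  then show ?thesis using False by (simp add: degree_def)
qed

lemma degree_remove:
  assumes "finite E" "e \<in> E"
  shows "degree (E - {e}) w = degree E w - of_bool (w \<in> e)"
  using degree_insert[of "E - {e}" e w] assms(1) by (simp add: insert_absorb[OF assms(2)])

text \<open>The map sending \<open>x\<close> to \<open>{u, x}\<close> is a bijection from the
  neighbours of \<open>u\<close> onto the edges at \<open>u\<close>. Degrees can then be compared by
  inclusions between neighbourhoods.\<close>

lemma degree_eq_card_neighbours:
  assumes "simple_graph V E"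
  shows "degree E u = card {x. {u, x} \<in> E}"
proof -
  have "inj_on (\<lambda>x. {u, x}) {x. {u, x} \<in> E}"
    by (auto simp: inj_on_def doubleton_eq_iff)
  moreover have "(\<lambda>x. {u, x}) ` {x. {u, x} \<in> E} = {e \<in> E. u \<in> e}"
  proof (intro equalityI subsetI)
    fix e assume "e \<in> {e \<in> E. u \<in> e}"
    then have e: "e \<in> E" "u \<in> e" by auto
    then have "card e = 2" using assms by (auto simp: simple_graph_def nsets_def)
    then obtain a b where "e = {a, b}" by (auto simp: card_2_iff)
    with e show "e \<in> (\<lambda>x. {u, x}) ` {x. {u, x} \<in> E}" by (auto simp: insert_commute)
  qed auto
  ultimately show ?thesis using card_image by (fastforce simp: degree_def)
qed

lemma finite_neighbours:
  assumes "simple_graph V E"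
  shows "finite {x. {u, x} \<in> E}"
  by (rule finite_subset[of _ V])
    (use assms in \<open>auto simp: simple_graph_def nsets_def\<close>)

lemma handshake:
  assumes "simple_graph V E"
  shows "(\<Sum>v\<in>V. degree E v) = 2 * card E"
proof -
  have "card {v \<in> V. v \<in> e} = 2" if "e \<in> E" for e
  proof -
    have "e \<subseteq> V" "card e = 2" using that assms by (auto simp: simple_graph_def nsets_def)
    moreover from this have "{v \<in> V. v \<in> e} = e" by auto
    ultimately show ?thesis by simp
  qed
  then show ?thesis unfolding degree_def
    using assms simple_graph_finite[OF assms]
    by (intro sum_multicount) (auto simp: simple_graph_def)
qed

text \<open>The neighbours of \<open>v\<close> in the graph and in its complement partition
  \<open>V - {v}\<close>; the 1 counts \<open>v\<close> itself. The additive form avoids truncated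
  subtraction.\<close>

lemma degree_complement:
  assumes "simple_graph V E" "v \<in> V"
  shows "degree ([V]\<^bsup>2\<^esup> - E) v + degree E v + 1 = card V"
proof -
  have G: "simple_graph V ([V]\<^bsup>2\<^esup> - E)" and fin: "finite V"
    using assms by (auto simp: simple_graph_def)
  have "{x. {v, x} \<in> [V]\<^bsup>2\<^esup> - E} \<union> {x. {v, x} \<in> E} = V - {v}"
    using assms by (auto simp: simple_graph_def nsets_def)
  moreover have "card ({x. {v, x} \<in> [V]\<^bsup>2\<^esup> - E} \<union> {x. {v, x} \<in> E}) =
      card {x. {v, x} \<in> [V]\<^bsup>2\<^esup> - E} + card {x. {v, x} \<in> E}"
    by (intro card_Un_disjoint finite_neighbours[OF G] finite_neighbours[OF assms(1)]) auto
  ultimately have "degree ([V]\<^bsup>2\<^esup> - E) v + degree E v = card (V - {v})"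
    unfolding degree_eq_card_neighbours[OF G] degree_eq_card_neighbours[OF assms(1)] by metis
  then show ?thesis
    using card_Suc_Diff1[OF fin assms(2)] by simp
qed

text \<open>If there is no alternating trail from \<open>u\<close> to \<open>v\<close> of length three, then a neighbour \<open>x\<close> of \<open>u\<close>
  is adjacent to \<open>u\<close> and to all of \<open>N(v) - {x}\<close>, and also to \<open>v\<close> if \<open>x \<in> N(v)\<close>. So its degree
  exceeds that of \<open>v\<close>.\<close>

lemma alternating_trail_exists:
  assumes G: "simple_graph V E"
    and max: "\<And>w. w \<in> V \<Longrightarrow> degree E w \<le> degree E v"
    and "degree E u > 0" and nadj: "{u, v} \<notin> E" and "u \<noteq> v"
  obtains x y where "{u, x} \<in> E" "{v, y} \<in> E" "x \<noteq> y" "{x, y} \<notin> E"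
proof -
  note deg = degree_eq_card_neighbours[OF G] and fin = finite_neighbours[OF G]
  from \<open>degree E u > 0\<close> obtain x where x: "{u, x} \<in> E"
    unfolding deg card_gt_0_iff by auto
  then have "x \<in> V" using G by (auto simp: simple_graph_def nsets_def)
  have "\<exists>y. {v, y} \<in> E \<and> x \<noteq> y \<and> {x, y} \<notin> E"
  proof (rule ccontr)
    assume none: "\<nexists>y. {v, y} \<in> E \<and> x \<noteq> y \<and> {x, y} \<notin> E"
    let ?N = "\<lambda>w. {z. {w, z} \<in> E}"
    have u: "u \<notin> ?N v" using nadj by (simp add: insert_commute)
    have vv: "{v, v} \<notin> E" using G by (auto simp: simple_graph_def nsets_def)
    have "card (insert u (?N v)) \<le> card (?N x)"
    proof (cases "x \<in> ?N v")
      case True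
      \<comment> \<open>\<open>x\<close> is not its own neighbour and must be left out of the
        neighbourhood of \<open>v\<close>; the new element \<open>v\<close> makes up for this loss,
        and \<open>u\<close> gives the strict excess.\<close>
      then have "insert v (insert u (?N v - {x})) \<subseteq> ?N x"
        using none x by (auto simp: insert_commute)
      then have "card (insert v (insert u (?N v - {x}))) \<le> card (?N x)"
        by (intro card_mono fin)
      moreover have "card (insert v (insert u (?N v - {x}))) = Suc (Suc (card (?N v - {x})))"
        using u vv \<open>u \<noteq> v\<close> fin by simp
      moreover have "Suc (card (?N v - {x})) = card (?N v)"
        by (rule card_Suc_Diff1[OF fin True])
      moreover have "card (insert u (?N v)) = Suc (card (?N v))"
        using u fin by simp
      ultimately show ?thesis by linarith
    next
      case False
      then have "insert u (?N v) \<subseteq> ?N x"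
        using none x by (auto simp: insert_commute)
      then show ?thesis by (intro card_mono fin)
    qed
    moreover have "card (insert u (?N v)) = Suc (card (?N v))"
      using u fin by simp
    ultimately show False using max[OF \<open>x \<in> V\<close>] by (simp add: deg)
  qed
  then show thesis using that x by blast
qed

text \<open>If \<open>u\<close> and \<open>v\<close> are adjacent, their edge is deleted. Otherwise,
  along an alternating trail \<open>u\<close>, \<open>x\<close>, \<open>y\<close>, \<open>v\<close>,
  the two outer edges are deleted and the middle one is added, so that \<open>x\<close> and
  \<open>y\<close> keep their degrees.\<close>

lemma lower_two_degrees:
  assumes G: "simple_graph V E"
    and max: "\<And>w. w \<in> V \<Longrightarrow> degree E w \<le> degree E v"
    and pos: "degree E u > 0" and "u \<noteq> v"
  obtains F where "simple_graph V F" "card (sym_diff E F) \<le> 3"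
    "\<And>w. degree F w = degree E w - of_bool (w \<in> {u, v})"
proof (cases "{u, v} \<in> E")
  case True
  show thesis
  proof
    show "simple_graph V (E - {{u, v}})" using G by (auto simp: simple_graph_def)
    have "sym_diff E (E - {{u, v}}) = {{u, v}}" using True by auto
    then show "card (sym_diff E (E - {{u, v}})) \<le> 3" by simp
    show "degree (E - {{u, v}}) w = degree E w - of_bool (w \<in> {u, v})" for w
      using degree_remove[OF simple_graph_finite[OF G] True] .
  qed
next
  case False
  obtain x y where xy: "{u, x} \<in> E" "{v, y} \<in> E" "x \<noteq> y" "{x, y} \<notin> E"
    using alternating_trail_exists[OF G max pos False \<open>u \<noteq> v\<close>] .
  have fin: "finite E" using simple_graph_finite[OF G] .
  have V: "x \<in> V" "y \<in> V" using xy G by (auto simp: simple_graph_def nsets_def)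
  have ne: "u \<noteq> x" "v \<noteq> y" using xy G by (auto simp: simple_graph_def nsets_def)
  \<comment> \<open>An equality here would make \<open>{u, v}\<close> an edge. Hence the two edges
    to be deleted are distinct.\<close>
  have ne': "v \<noteq> x" "u \<noteq> y" using xy False by (auto simp: insert_commute)
  have dist: "{u, x} \<noteq> {v, y}" using \<open>u \<noteq> v\<close> ne' by (auto simp: doubleton_eq_iff)
  define F where "F = insert {x, y} (E - {{u, x}} - {{v, y}})"
  show thesis
  proof
    show "simple_graph V F" using G V \<open>x \<noteq> y\<close> by (auto simp: simple_graph_def F_def)
    have "sym_diff E F \<subseteq> {{u, x}, {v, y}, {x, y}}" by (auto simp: F_def)
    then have "card (sym_diff E F) \<le> card {{u, x}, {v, y}, {x, y}}"
      by (intro card_mono) auto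
    also have "\<dots> \<le> 3" by (intro order.trans[OF card_insert_le_m1]) (auto simp: card_insert_if)
    finally show "card (sym_diff E F) \<le> 3" .
    fix w
    have rem: "degree F w = degree E w - of_bool (w \<in> {u, x}) - of_bool (w \<in> {v, y})
        + of_bool (w \<in> {x, y})"
      using xy dist fin unfolding F_def by (simp add: degree_insert degree_remove)
    \<comment> \<open>With truncated subtraction, losing one edge and gaining one restores the
      degree of \<open>x\<close> and \<open>y\<close> only if it was positive.\<close>
    have "degree E w > 0" if "w \<in> {x, y}"
    proof -
      have "{e \<in> E. w \<in> e} \<noteq> {}" using that xy by auto
      then show ?thesis using fin by (simp add: degree_def card_gt_0_iff)
    qed
    then show "degree F w = degree E w - of_bool (w \<in> {u, v})"
      unfolding rem using ne ne' \<open>x \<noteq> y\<close> \<open>u \<noteq> v\<close> by auto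
  qed
qed

lemma card_sym_diff_triangle:
  assumes "finite A" "finite B" "finite C"
  shows "card (sym_diff A C) \<le> card (sym_diff A B) + card (sym_diff B C)"
proof -
  have "card (sym_diff A C) \<le> card (sym_diff A B \<union> sym_diff B C)"
    using assms by (intro card_mono) auto
  also have "\<dots> \<le> card (sym_diff A B) + card (sym_diff B C)" by (rule card_Un_le)
  finally show ?thesis .
qed

text \<open>Induction on the number of pairs: each step moves two vertices from degree
  \<open>d + 1\<close> to \<open>d\<close> at a cost of at most three edges, and the costs add up by
  the triangle inequality.\<close>

lemma regularize_by_lowering:
  assumes "simple_graph V E"
    and "\<forall>v\<in>V. degree E v = d \<or> degree E v = d + 1"
    and "card {v \<in> V. degree E v = d + 1} = 2 * k"
  shows "\<exists>F. regular_graph d V F \<and> card (sym_diff E F) \<le> 3 * k"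
  using assms
proof (induction k arbitrary: E)
  case 0
  then have "{v \<in> V. degree E v = d + 1} = {}"
    by (simp add: simple_graph_def)
  with 0 have "regular_graph d V E" by (auto simp: regular_graph_def)
  then show ?case by (intro exI[of _ E]) simp
next
  case (Suc k)
  let ?A = "{v \<in> V. degree E v = d + 1}"
  have finA: "finite ?A" using Suc.prems(1) by (simp add: simple_graph_def)
  have "2 \<le> card ?A" using Suc.prems(3) by simp
  then obtain T where "T \<subseteq> ?A" "card T = 2" by (meson obtain_subset_with_card_n)
  then obtain u v where uv: "u \<in> ?A" "v \<in> ?A" "u \<noteq> v" by (auto simp: card_2_iff)
  \<comment> \<open>Every vertex of degree \<open>d + 1\<close> has maximum degree, so any two of
    them can serve as the pair.\<close>
  have max: "degree E w \<le> degree E v" if "w \<in> V" for w using uv that Suc.prems(2) by fastforce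
  have "degree E u > 0" using uv by simp
  then obtain F where F: "simple_graph V F" "card (sym_diff E F) \<le> 3"
    and deg: "\<And>w. degree F w = degree E w - of_bool (w \<in> {u, v})"
    using lower_two_degrees[OF Suc.prems(1) max _ \<open>u \<noteq> v\<close>] by metis
  have "{w \<in> V. degree F w = d + 1} = ?A - {u, v}"
    using uv Suc.prems(2) by (auto simp: deg)
  moreover have "card (?A - {u, v}) = 2 * k"
    using uv Suc.prems(3) finA by (subst card_Diff_subset) auto
  moreover have "\<forall>w\<in>V. degree F w = d \<or> degree F w = d + 1"
    using uv Suc.prems(2) by (auto simp: deg)
  ultimately obtain R where R: "regular_graph d V R" "card (sym_diff F R) \<le> 3 * k"
    using Suc.IH[OF F(1)] by auto
  have "finite R" using R simple_graph_finite by (auto simp: regular_graph_def)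
  then have "card (sym_diff E R) \<le> card (sym_diff E F) + card (sym_diff F R)"
    using simple_graph_finite F(1) Suc.prems(1) by (intro card_sym_diff_triangle) auto
  with F R show ?case by (intro exI[of _ R]) simp
qed

text \<open>Complementation exchanges the roles of the two degrees: vertices of degree
  \<open>d\<close> become those of the larger degree, which can be lowered.\<close>

lemma regularize_by_raising:
  assumes G: "simple_graph V E"
    and deg: "\<forall>v\<in>V. degree E v = d \<or> degree E v = d + 1"
    and k: "card {v \<in> V. degree E v = d} = 2 * k"
    and room: "card V \<ge> d + 2"
  shows "\<exists>F. regular_graph (d + 1) V F \<and> card (sym_diff E F) \<le> 3 * k"
proof -
  let ?C = "[V]\<^bsup>2\<^esup> - E"
  \<comment> \<open>\<open>c\<close> is the complement degree of a vertex of degree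
    \<open>d + 1\<close>; \<open>room\<close> makes it a natural number.\<close>
  from room obtain c where c: "card V = c + d + 2" by (metis add.commute add.assoc le_Suc_ex)
  have C: "simple_graph V ?C" using G by (auto simp: simple_graph_def)
  have degC: "degree ?C v + degree E v = c + d + 1" if "v \<in> V" for v
    using degree_complement[OF G that] c by simp
  have "{v \<in> V. degree ?C v = c + 1} = {v \<in> V. degree E v = d}"
    using degC deg by force
  moreover have "\<forall>v\<in>V. degree ?C v = c \<or> degree ?C v = c + 1"
    using degC deg by force
  ultimately obtain R where R: "regular_graph c V R" "card (sym_diff ?C R) \<le> 3 * k"
    using regularize_by_lowering[OF C, of c k] k by auto
  have RG: "simple_graph V R" using R by (simp add: regular_graph_def)
  have "regular_graph (d + 1) V ([V]\<^bsup>2\<^esup> - R)"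
    unfolding regular_graph_def
  proof (intro conjI ballI)
    show "simple_graph V ([V]\<^bsup>2\<^esup> - R)" using RG by (auto simp: simple_graph_def)
    show "degree ([V]\<^bsup>2\<^esup> - R) v = d + 1" if "v \<in> V" for v
      using degree_complement[OF RG that] c R that by (simp add: regular_graph_def)
  qed
  \<comment> \<open>Complementing both edge sets does not change where they differ, so the bound
    carries over.\<close>
  moreover have "sym_diff E ([V]\<^bsup>2\<^esup> - R) = sym_diff ?C R"
    using G RG by (auto simp: simple_graph_def)
  ultimately show ?thesis using R by metis
qed

theorem theorem3:
  fixes V :: "'a set" and E :: "'a set set" and n d :: nat
  assumes "simple_graph V E"
    and "card V = n"
    and "\<forall>v\<in>V. degree E v = d \<or> degree E v = d + 1"
  shows "\<exists>r F. (r = d \<or> r = d + 1) \<and> regular_graph r V F \<and>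
           real (card (sym_diff E F)) \<le> 3 * real n / 2"
proof -
  let ?A = "{v \<in> V. degree E v = d + 1}" and ?B = "{v \<in> V. degree E v = d}"
  have fin: "finite V" using assms(1) by (simp add: simple_graph_def)
  have V: "V = ?A \<union> ?B" using assms(3) by auto
  have n: "n = card ?A + card ?B"
    using fin assms(2) by (subst (asm) V, subst (asm) card_Un_disjoint) auto
  have "2 * card E = (\<Sum>v\<in>V. degree E v)" using handshake[OF assms(1)] by simp
  also have "\<dots> = (\<Sum>v\<in>V. d + of_bool (v \<in> ?A))"
    using assms(3) by (intro sum.cong) auto
  also have "\<dots> = n * d + card ?A"
    using fin assms(2) by (simp add: sum.distrib of_bool_def flip: sum.inter_filter)
  finally have parity: "even (n * d + card ?A)" by (metis dvd_triv_left)
  show ?thesis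
  proof (cases "even (card ?A)")
    case True
    then obtain k where k: "card ?A = 2 * k" by blast
    then obtain F where "regular_graph d V F" "card (sym_diff E F) \<le> 3 * k"
      using regularize_by_lowering[OF assms(1,3)] by blast
    moreover have "3 * real k \<le> 3 * real n / 2" using k n by simp
    ultimately show ?thesis by (intro exI[of _ d] exI[of _ F]) linarith
  next
    case False
    \<comment> \<open>Since \<open>card ?A\<close> is odd, \<open>n * d\<close> must be odd
      too.\<close>
    then have "odd n" using parity by auto
    then have "even (card ?B)" using n False by simp
    then obtain k where k: "card ?B = 2 * k" by blast
    \<comment> \<open>A vertex of degree \<open>d + 1\<close> together with its neighbours gives the
      \<open>d + 2\<close> vertices required for raising.\<close>
    have "?A \<noteq> {}" using False by (metis card.empty even_zero)
    then obtain v where "v \<in> V" "degree E v = d + 1" by auto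
    then have "card V \<ge> d + 2" using degree_complement[OF assms(1), of v] by simp
    then obtain F where "regular_graph (d + 1) V F" "card (sym_diff E F) \<le> 3 * k"
      using regularize_by_raising[OF assms(1,3) k] by blast
    moreover have "3 * real k \<le> 3 * real n / 2" using k n by simp
    ultimately show ?thesis by (intro exI[of _ "d + 1"] exI[of _ F]) linarith
  qed
qed

end
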